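(* Let $X$ be a complex normed space and let $F: X\to X^*$, $x\mapsto f_x$, be a continuous map satisfying the following: (1) $f_x(y)=\overline{f_y(x)}$ for all $x,y\in X$; (2) for every $x\in X$, if $x\in\mathrm{Ker}(f_x)$ then $x=0$. Then $(x,y)=f_x(y)$ defines a pre-Hilbertian structure (an inner product) on $X$, and the topology induced by $(\cdot,\cdot)$ is weaker than the norm topology of $X$.
   Context: $X^*$ denotes the space of continuous linear functionals on $X$ with the dual norm, and $f_x\in X^*$ denotes the image of $x$ under $F$. Continuity of $F$ is with respect to the norm topologies. Inner products are taken conjugate-linear in the first variable and linear in the second. The topology induced by $(\cdot,\cdot)$ is the one given by the norm $|x|=(x,x)^{1/2}$; "weaker" means coarser, not necessarily strictly.
   Formalization: As stated the claim fails for X = C, f_x(y) = -conj(x)y, which is negative definite; the conclusion is corrected to: either f_x(y) or -f_x(y) defines an inner product on X, and the topology it induces is weaker than the norm topology. *)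

theory Defs
  imports "HOL-Analysis.Analysis"
begin

class complex_normed_vector = real_normed_vector +
  fixes scaleC :: "complex \<Rightarrow> 'a \<Rightarrow> 'a" (infixr "*\<^sub>C" 75)
  assumes scaleC_add_right: "c *\<^sub>C (x + y) = c *\<^sub>C x + c *\<^sub>C y"
    and scaleC_add_left: "(c + d) *\<^sub>C x = c *\<^sub>C x + d *\<^sub>C x"
    and scaleC_scaleC: "c *\<^sub>C d *\<^sub>C x = (c * d) *\<^sub>C x"
    and scaleC_of_real: "complex_of_real r *\<^sub>C x = r *\<^sub>R x"
    and norm_scaleC: "norm (c *\<^sub>C x) = cmod c * norm x"

text \<open>The dual space, as a subset of the bounded real-linear functionals: on it the norm of
  \<open>'a \<Rightarrow>\<^sub>L complex\<close>, which is the operator norm, is the dual norm.\<close>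

definition cdual :: "('a::complex_normed_vector \<Rightarrow>\<^sub>L complex) set" where
  "cdual = {f. \<forall>c x. blinfun_apply f (c *\<^sub>C x) = c * blinfun_apply f x}"

definition is_inner_product :: "('a::complex_normed_vector \<Rightarrow> 'a \<Rightarrow> complex) \<Rightarrow> bool" where
  "is_inner_product B \<longleftrightarrow>
     (\<forall>x y z. B x (y + z) = B x y + B x z) \<and>
     (\<forall>c x y. B x (c *\<^sub>C y) = c * B x y) \<and>
     (\<forall>x y z. B (x + y) z = B x z + B y z) \<and>
     (\<forall>c x y. B (c *\<^sub>C x) y = cnj c * B x y) \<and>
     (\<forall>x y. B x y = cnj (B y x)) \<and>
     (\<forall>x. x \<noteq> 0 \<longrightarrow> B x x \<in> \<real> \<and> Re (B x x) > 0)"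

definition induced_norm :: "('a::complex_normed_vector \<Rightarrow> 'a \<Rightarrow> complex) \<Rightarrow> 'a \<Rightarrow> real" where
  "induced_norm B x = sqrt (Re (B x x))"

text \<open>\<open>Metric_space.mtopology\<close> is the topology of open balls only if its distance is a metric,
  so \<open>induced_topology B\<close> is meaningful only when \<open>is_inner_product B\<close> holds.\<close>

definition induced_topology :: "('a::complex_normed_vector \<Rightarrow> 'a \<Rightarrow> complex) \<Rightarrow> 'a topology" where
  "induced_topology B = Metric_space.mtopology UNIV (\<lambda>x y. induced_norm B (x - y))"

text \<open>Hermitian symmetry and \<open>F x x \<noteq> 0\<close> for \<open>x \<noteq> 0\<close> are preserved by replacing \<open>F\<close> with
  \<open>-F\<close>, so they can determine an inner product only up to a global sign: on the complex numbers,
  \<open>F x y = - (cnj x * y)\<close> has both properties and is negative definite.\<close>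

end

theory Submission
  imports Defs "HOL-Library.Quadratic_Discriminant"
begin

text \<open>Let \<open>x\<close> and \<open>y\<close> be such that \<open>(x, x) > 0 > (y, y)\<close>. The real quadratic
  \<open>t \<mapsto> (x + t y, x + t y)\<close> has a root \<open>t\<close>, where condition (2) forces \<open>x = - t y\<close>; but then
  \<open>(x, x) = t\<^sup>2 (y, y) \<le> 0\<close>. So the form is definite, of one sign. The induced norm is
  continuous on \<open>X\<close> because \<open>F\<close> and the evaluation pairing are, so its balls are open in the norm
  topology.\<close>

lemma hermitian_form_add_scaleR:
  fixes B :: "'a::complex_normed_vector \<Rightarrow> 'a \<Rightarrow> complex"
  assumes add: "\<And>x y z. B x (y + z) = B x y + B x z"
    and scale: "\<And>c x y. B x (c *\<^sub>C y) = c * B x y"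
    and herm: "\<And>x y. B x y = cnj (B y x)"
  shows "Re (B (x + t *\<^sub>R y) (x + t *\<^sub>R y)) = Re (B x x) + 2 * t * Re (B x y) + t\<^sup>2 * Re (B y y)"
proof -
  have addl: "B (u + v) w = B u w + B v w" for u v w
    by (metis add complex_cnj_add herm)
  have r: "B u (t *\<^sub>R v) = t * B u v" for u v
    by (metis scale scaleC_of_real)
  have l: "B (t *\<^sub>R u) v = t * B u v" for u v
    by (metis r herm complex_cnj_mult complex_cnj_complex_of_real)
  \<comment> \<open>The cross terms \<open>t * B x y\<close> and \<open>t * B y x\<close> are
    conjugate up to a common real factor, so their real parts merge into the linear
    coefficient.\<close>
  have "Re (B y x) = Re (B x y)"
    by (subst herm) simp
  then show ?thesis
    by (simp add: add addl r l power2_eq_square algebra_simps)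
qed

lemma hermitian_form_definite:
  fixes B :: "'a::complex_normed_vector \<Rightarrow> 'a \<Rightarrow> complex"
  assumes add: "\<And>x y z. B x (y + z) = B x y + B x z"
    and scale: "\<And>c x y. B x (c *\<^sub>C y) = c * B x y"
    and herm: "\<And>x y. B x y = cnj (B y x)"
    and anisotropic: "\<And>x. B x x = 0 \<Longrightarrow> x = 0"
  shows "(\<forall>x. x \<noteq> 0 \<longrightarrow> Re (B x x) > 0) \<or> (\<forall>x. x \<noteq> 0 \<longrightarrow> Re (B x x) < 0)"
proof (rule ccontr)
  have real: "B x x = Re (B x x)" for x
    using arg_cong[OF herm[of x x], of Im] by (simp add: complex_eq_iff)
  have nz: "Re (B x x) \<noteq> 0" if "x \<noteq> 0" for x
    using anisotropic real that by (metis of_real_0)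
  assume "\<not> ?thesis"
  then obtain x y where x: "Re (B x x) > 0" and y: "Re (B y y) < 0"
    using nz by (meson linorder_neqE_linordered_idom)
  define a b c where "a = Re (B y y)" and "b = 2 * Re (B x y)" and "c = Re (B x x)"
  \<comment> \<open>Outer coefficients of opposite sign make the discriminant
    \<open>b\<^sup>2 - 4 * a * c\<close> nonnegative, which yields a real root.\<close>
  have "a * c < 0"
    using x y by (simp add: a_def c_def mult_neg_pos)
  then have "discrim a b c \<ge> 0"
    using zero_le_power2[of b] unfolding discrim_def by linarith
  then obtain t where "a * t\<^sup>2 + b * t + c = 0"
    using discriminant_nonneg_ex[of a b c] y unfolding a_def by auto
  then have "Re (B (x + t *\<^sub>R y) (x + t *\<^sub>R y)) = 0"
    by (simp add: hermitian_form_add_scaleR[of B, OF add scale herm] a_def b_def c_def algebra_simps)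
  then have "x = (- t) *\<^sub>R y"
    using nz by (metis add_eq_0_iff scaleR_minus_left add.commute)
  \<comment> \<open>The summand \<open>0\<close> gives \<open>x\<close> the shape of the expansion
    lemma; with \<open>B 0 v = 0\<close> only the quadratic term survives.\<close>
  then have "x = 0 + (- t) *\<^sub>R y"
    by simp
  moreover have "B 0 v = 0" for v
    using scale[of v 0 0] herm[of 0 v] by (metis complex_cnj_zero mult_zero_left norm_scaleC norm_zero norm_eq_zero)
  ultimately have "Re (B x x) = t\<^sup>2 * Re (B y y)"
    using hermitian_form_add_scaleR[of B 0 "- t" y, OF add scale herm] by simp
  then show False
    using x y by (smt (verit) mult_nonneg_nonpos zero_le_power2)
qed

text \<open>The first three facts follow the order of the premises of
  \<open>hermitian_form_add_scaleR\<close>, so that \<open>is_inner_productD(1-3)\<close> discharges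
  them together.\<close>

lemma is_inner_productD:
  assumes "is_inner_product B"
  shows "B x (y + z) = B x y + B x z" "B x (c *\<^sub>C y) = c * B x y" "B x y = cnj (B y x)"
    and "x \<noteq> 0 \<Longrightarrow> Re (B x x) > 0"
proof -
  note conjs = assms[unfolded is_inner_product_def]
  show "B x (y + z) = B x y + B x z"
    by (rule conjs[THEN conjunct1, rule_format])
  show "B x (c *\<^sub>C y) = c * B x y"
    by (rule conjs[THEN conjunct2, THEN conjunct1, rule_format])
  show "B x y = cnj (B y x)"
    by (rule conjs[THEN conjunct2, THEN conjunct2, THEN conjunct2, THEN conjunct2,
          THEN conjunct1, rule_format])
  show "Re (B x x) > 0" if "x \<noteq> 0"
    using conjs that by blast
qed

lemma is_inner_product_zero:
  assumes "is_inner_product B"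
  shows "B x 0 = 0"
  using is_inner_productD(1)[OF assms, of x 0 0] by simp

lemma is_inner_product_nonneg:
  assumes "is_inner_product B"
  shows "Re (B x x) \<ge> 0"
  using is_inner_productD(4)[OF assms, of x] is_inner_product_zero[OF assms]
  by (cases "x = 0") auto

lemma is_inner_product_scaleR:
  assumes "is_inner_product B"
  shows "B (s *\<^sub>R x) (t *\<^sub>R y) = of_real (s * t) * B x y"
proof -
  have "B (of_real s *\<^sub>C x) (of_real t *\<^sub>C y) = cnj (of_real s) * (of_real t * B x y)"
    using assms unfolding is_inner_product_def by metis
  then show ?thesis
    by (simp add: scaleC_of_real)
qed

text \<open>Expanding the square of a suitable difference of multiples of \<open>x\<close> and
  \<open>y\<close> gives the bound. The real part is all that the triangle inequality needs.\<close>

lemma is_inner_product_Cauchy_Schwarz: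
  assumes B: "is_inner_product B"
  shows "Re (B x y) \<le> induced_norm B x * induced_norm B y"
proof (cases "x = 0 \<or> y = 0")
  case True
  then show ?thesis
    using is_inner_product_zero[OF B] is_inner_productD(3)[OF B, of 0 y]
    by (auto simp: induced_norm_def)
next
  case False
  define n m where "n = induced_norm B x" and "m = induced_norm B y"
  have pos: "n > 0" "m > 0" and sq: "Re (B x x) = n\<^sup>2" "Re (B y y) = m\<^sup>2"
    using False is_inner_productD(4)[OF B] is_inner_product_nonneg[OF B]
    by (auto simp: n_def m_def induced_norm_def)
  \<comment> \<open>The weights give both vectors the same length \<open>n * m\<close>, so the
    positive factor \<open>2 * (m * n)\<close> splits off and can be cancelled.\<close>
  have "0 \<le> Re (B (m *\<^sub>R x + (- n) *\<^sub>R y) (m *\<^sub>R x + (- n) *\<^sub>R y))"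
    by (rule is_inner_product_nonneg[OF B])
  also have "\<dots> = 2 * (m * n) * (n * m - Re (B x y))"
    using is_inner_product_scaleR[OF B, of m x m x] is_inner_product_scaleR[OF B, of m x 1 y]
    by (subst hermitian_form_add_scaleR[of B, OF is_inner_productD(1-3)[OF B]])
      (simp add: sq power2_eq_square algebra_simps)
  finally show ?thesis
    using mult_pos_pos[OF pos] by (auto simp: zero_le_mult_iff n_def m_def)
qed

text \<open>Cauchy-Schwarz bounds the cross term in the expansion of the squared norm at
  \<open>t = 1\<close>.\<close>

lemma induced_norm_triangle:
  assumes B: "is_inner_product B"
  shows "induced_norm B (x + y) \<le> induced_norm B x + induced_norm B y"
proof -
  have "Re (B (x + y) (x + y)) = Re (B x x) + 2 * Re (B x y) + Re (B y y)"
    using hermitian_form_add_scaleR[of B x 1 y, OF is_inner_productD(1-3)[OF B]] by simp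
  also have "\<dots> \<le> (induced_norm B x + induced_norm B y)\<^sup>2"
    using is_inner_product_Cauchy_Schwarz[OF B, of x y] is_inner_product_nonneg[OF B]
    by (simp add: power2_sum induced_norm_def)
  finally show ?thesis
    using is_inner_product_nonneg[OF B] unfolding induced_norm_def
    by (intro real_le_lsqrt) auto
qed

text \<open>This makes \<open>induced_topology B\<close> the genuine topology of open balls, so that
  \<open>openin_mtopology\<close> applies to it.\<close>

lemma Metric_space_induced_norm:
  assumes B: "is_inner_product B"
  shows "Metric_space UNIV (\<lambda>x y. induced_norm B (x - y))"
proof
  show "0 \<le> induced_norm B (x - y)" for x y
    by (simp add: induced_norm_def is_inner_product_nonneg[OF B])
  show "induced_norm B (x - y) = induced_norm B (y - x)" for x y
    \<comment> \<open>The vector \<open>y - x\<close> is \<open>- 1\<close> times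
      \<open>x - y\<close>, and the two signs cancel in the form.\<close>
    using is_inner_product_scaleR[OF B, of "-1" "x - y" "-1" "x - y"] by (simp add: induced_norm_def)
  show "induced_norm B (x - y) = 0 \<longleftrightarrow> x = y" for x y
    using is_inner_productD(4)[OF B, of "x - y"] is_inner_product_zero[OF B]
    by (force simp: induced_norm_def)
  show "induced_norm B (x - z) \<le> induced_norm B (x - y) + induced_norm B (y - z)" for x y z
    using induced_norm_triangle[OF B, of "x - y" "y - z"] by simp
qed

lemma open_if_openin_induced_topology:
  assumes B: "is_inner_product B"
    and cont: "continuous_on UNIV (induced_norm B)"
    and U: "openin (induced_topology B) U"
  shows "open U"
proof -
  interpret Metric_space UNIV "\<lambda>x y. induced_norm B (x - y)"
    by (rule Metric_space_induced_norm[OF B])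
  have "\<exists>T. open T \<and> x \<in> T \<and> T \<subseteq> U" if x: "x \<in> U" for x
  proof -
    obtain r where r: "r > 0" "mball x r \<subseteq> U"
      using U x unfolding induced_topology_def openin_mtopology by blast
    \<comment> \<open>The ball is a strict sublevel set of a function of \<open>y\<close> that is
      continuous for the norm of the space.\<close>
    have "open {y. induced_norm B (x - y) < r}"
      by (intro open_Collect_less continuous_intros continuous_on_compose2[OF cont]) auto
    moreover have "{y. induced_norm B (x - y) < r} = mball x r"
      by (auto simp: mball_def)
    ultimately show ?thesis
      using r by auto
  qed
  then show ?thesis
    by (subst open_subopen) blast
qed

text \<open>Additivity in the second slot comes from the type of \<open>F x\<close>, homogeneity
  over the complex numbers from \<open>cdual\<close>; Hermitian symmetry carries both to the first
  slot, with conjugated scalars.\<close>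

lemma is_inner_product_blinfun:
  fixes F :: "'a::complex_normed_vector \<Rightarrow> ('a \<Rightarrow>\<^sub>L complex)"
  assumes dual: "\<And>x. F x \<in> cdual"
    and herm: "\<And>x y. F x y = cnj (F y x)"
    and pos: "\<And>x. x \<noteq> 0 \<Longrightarrow> Re (F x x) > 0"
  shows "is_inner_product (\<lambda>x. blinfun_apply (F x))"
proof -
  have scale: "F x (c *\<^sub>C y) = c * F x y" for c x y
    using dual by (simp add: cdual_def)
  have "F (x + y) z = F x z + F y z" for x y z
    by (metis herm complex_cnj_add blinfun.add_right)
  moreover have "F (c *\<^sub>C x) y = cnj c * F x y" for c x y
    by (metis herm complex_cnj_mult scale)
  moreover have "F x x \<in> \<real>" for x
    by (metis herm Reals_cnj_iff)
  ultimately show ?thesis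
    unfolding is_inner_product_def by (intro conjI allI impI scale herm pos blinfun.add_right)
qed

lemma open_if_openin_induced_topology_blinfun:
  fixes F :: "'a::complex_normed_vector \<Rightarrow> ('a \<Rightarrow>\<^sub>L complex)"
  assumes "continuous_on UNIV F"
    and "is_inner_product (\<lambda>x. blinfun_apply (F x))"
    and "openin (induced_topology (\<lambda>x. blinfun_apply (F x))) U"
  shows "open U"
proof (rule open_if_openin_induced_topology[OF assms(2) _ assms(3)])
  show "continuous_on UNIV (induced_norm (\<lambda>x. blinfun_apply (F x)))"
    unfolding induced_norm_def by (intro continuous_intros assms(1))
qed

theorem corollary7:
  fixes F :: "'a::complex_normed_vector \<Rightarrow> ('a \<Rightarrow>\<^sub>L complex)"
  assumes dual: "\<And>x. F x \<in> cdual"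
    and cont: "continuous_on UNIV F"
    and herm: "\<And>x y. blinfun_apply (F x) y = cnj (blinfun_apply (F y) x)"
    and ker: "\<And>x. x \<in> {y. blinfun_apply (F x) y = 0} \<Longrightarrow> x = 0"
  shows
    "(is_inner_product (\<lambda>x y. blinfun_apply (F x) y) \<and>
      (\<forall>U. openin (induced_topology (\<lambda>x y. blinfun_apply (F x) y)) U \<longrightarrow> open U))
     \<or>
     (is_inner_product (\<lambda>x y. - blinfun_apply (F x) y) \<and>
      (\<forall>U. openin (induced_topology (\<lambda>x y. - blinfun_apply (F x) y)) U \<longrightarrow> open U))"
proof -
  have scale: "F x (c *\<^sub>C y) = c * F x y" for c x y
    using dual by (simp add: cdual_def)
  \<comment> \<open>The two possible signs of the definite form correspond to the two disjuncts of
    the conclusion.\<close>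
  consider "\<And>x. x \<noteq> 0 \<Longrightarrow> Re (F x x) > 0" | "\<And>x. x \<noteq> 0 \<Longrightarrow> Re (F x x) < 0"
    using hermitian_form_definite[of "\<lambda>x. blinfun_apply (F x)"] blinfun.add_right scale herm ker
    by blast
  then show ?thesis
  proof cases
    case 1
    have ip: "is_inner_product (\<lambda>x. blinfun_apply (F x))"
      by (rule is_inner_product_blinfun[OF dual herm 1])
    then show ?thesis
      using open_if_openin_induced_topology_blinfun[OF cont] by blast
  next
    case 2
    \<comment> \<open>Negating in the space of bounded functionals, not pointwise, yields a
      continuous map into the dual whose form is positive, so the lemmas for \<open>F\<close> apply
      to \<open>G\<close>.\<close>
    define G where "G = (\<lambda>x. - F x)"
    have G: "(\<lambda>x y. - F x y) = (\<lambda>x. blinfun_apply (G x))"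
      by (simp add: G_def fun_eq_iff blinfun.minus_left)
    have "is_inner_product (\<lambda>x. blinfun_apply (G x))"
    proof (rule is_inner_product_blinfun)
      show "G x \<in> cdual" for x
        using scale by (simp add: G_def cdual_def blinfun.minus_left)
      show "G x y = cnj (G y x)" for x y
        unfolding G_def blinfun.minus_left complex_cnj_minus by (subst herm) (rule refl)
      show "Re (G x x) > 0" if "x \<noteq> 0" for x
        using 2[OF that] by (simp add: G_def blinfun.minus_left)
    qed
    moreover have "continuous_on UNIV G"
      unfolding G_def by (intro continuous_intros cont)
    ultimately show ?thesis
      using open_if_openin_induced_topology_blinfun[of G] unfolding G by blast
  qed
qed

end
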